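(* Let $p$ be a prime and let $G$ be an extra special group of order $p^{2n+1}$, i.e. $G$ is one of the two groups $H_n$ or $M_n$ described in the context. For every $\varepsilon>0$ there exists a positive integer $n_0=n_0(\varepsilon)$ such that if $n\ge n_0$, $B\subseteq G$ is a brick and $|B|>|G|^{3/4+\varepsilon}$, then $B\cdot B=\{bb': b,b'\in B\}$ contains at least $|B|/p$ cosets of the center $G'=[\vec 0,\vec 0,\mathbb{F}_p]=\{[\vec 0,\vec 0,z]:z\in\mathbb{F}_p\}$ of $G$ (a nontrivial subgroup).
   Context: An extra special group is a $p$-group whose center $Z(G)$ is cyclic of order $p$ and such that $G/Z(G)$ is elementary abelian; such groups have order $p^{2n+1}$, and for each $n\ge1$ there are exactly two up to isomorphism, $H_n$ and $M_n$. Concretely, both are realized on triples $[\vec{x},\vec{y},z]$ with $\vec{x},\vec{y}\in\mathbb{F}_p^n$, $z\in\mathbb{F}_p$: in $H_n$ (the Heisenberg group) the product is $[\vec{x},\vec{y},z]\cdot[\vec{x}',\vec{y}',z']=[\vec{x}+\vec{x}',\vec{y}+\vec{y}',z+z'+\langle\vec{x},\vec{y}'\rangle]$, and in $M_n$ it is $[\vec{x}+\vec{x}',\vec{y}+\vec{y}',z+z'+\langle\vec{x},\vec{y}'\rangle+f(\vec{y},\vec{y}')]$, where $\langle\vec{x},\vec{y}'\rangle=\sum_i x_iy_i'$ and $f(\vec{y},\vec{y}')=\sum_{i=1}^n\lfloor ((y_i\bmod p)+(y_i'\bmod p))/p\rfloor$, with $y\bmod p\in\{0,\dots,p-1\}$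 denoting $y\in\mathbb{F}_p$ regarded as an integer. In either coordinatization, a brick is a set $B=\{[\vec{x},\vec{y},z]: \vec{x}\in X_1\times\dots\times X_n,\ \vec{y}\in Y_1\times\dots\times Y_n,\ z\in Z\}$ with nonempty subsets $X_i,Y_i,Z\subseteq\mathbb{F}_p$. *)

theory Defs
  imports Complex_Main "HOL-Number_Theory.Residues"
begin

text \<open>
  \<open>n\<close> and \<open>p\<close> are quantified inside the theorem, so the vector space of dimension \<open>n\<close> over the
  prime field is an explicit carrier: extensional functions on \<open>{1..n}\<close> whose values are the
  representatives \<open>0, \<dots>, p - 1\<close> making up the carrier of \<^const>\<open>residue_ring\<close>.
\<close>

abbreviation Fp :: "nat \<Rightarrow> int ring"
  where "Fp p \<equiv> residue_ring (int p)"

definition vecs :: "nat \<Rightarrow> nat \<Rightarrow> (nat \<Rightarrow> int) set"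
  where "vecs p n = {1..n} \<rightarrow>\<^sub>E carrier (Fp p)"

definition vec_zero :: "nat \<Rightarrow> nat \<Rightarrow> nat \<Rightarrow> int"
  where "vec_zero p n = (\<lambda>i\<in>{1..n}. \<zero>\<^bsub>Fp p\<^esub>)"

definition vec_add :: "nat \<Rightarrow> nat \<Rightarrow> (nat \<Rightarrow> int) \<Rightarrow> (nat \<Rightarrow> int) \<Rightarrow> nat \<Rightarrow> int"
  where "vec_add p n x y = (\<lambda>i\<in>{1..n}. x i \<oplus>\<^bsub>Fp p\<^esub> y i)"

definition vec_dot :: "nat \<Rightarrow> nat \<Rightarrow> (nat \<Rightarrow> int) \<Rightarrow> (nat \<Rightarrow> int) \<Rightarrow> int"
  where "vec_dot p n x y = (\<Oplus>\<^bsub>Fp p\<^esub>i\<in>{1..n}. x i \<otimes>\<^bsub>Fp p\<^esub> y i)"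

text \<open>
  The number of carries: on integers \<open>div\<close> is the floor of the quotient, and the entries of \<open>y\<close>
  and \<open>y'\<close> already are the representatives in \<open>{0..p - 1}\<close>. The final \<open>mod\<close> reads the integer as
  a field element.
\<close>

definition vec_carry :: "nat \<Rightarrow> nat \<Rightarrow> (nat \<Rightarrow> int) \<Rightarrow> (nat \<Rightarrow> int) \<Rightarrow> int"
  where "vec_carry p n y y' = (\<Sum>i=1..n. (y i + y' i) div int p) mod int p"

type_synonym triple = "(nat \<Rightarrow> int) \<times> (nat \<Rightarrow> int) \<times> int"

text \<open>\<open>heis_group p n\<close> and \<open>carry_group p n\<close> are the extra special groups \<open>H\<^sub>n\<close> and \<open>M\<^sub>n\<close>.\<close>

definition heis_group :: "nat \<Rightarrow> nat \<Rightarrow> triple monoid"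
  where "heis_group p n =
    \<lparr>carrier = vecs p n \<times> vecs p n \<times> carrier (Fp p),
     monoid.mult = (\<lambda>(x, y, z) (x', y', z').
       (vec_add p n x x', vec_add p n y y', z \<oplus>\<^bsub>Fp p\<^esub> z' \<oplus>\<^bsub>Fp p\<^esub> vec_dot p n x y')),
     one = (vec_zero p n, vec_zero p n, \<zero>\<^bsub>Fp p\<^esub>)\<rparr>"

definition carry_group :: "nat \<Rightarrow> nat \<Rightarrow> triple monoid"
  where "carry_group p n =
    \<lparr>carrier = vecs p n \<times> vecs p n \<times> carrier (Fp p),
     monoid.mult = (\<lambda>(x, y, z) (x', y', z').
       (vec_add p n x x', vec_add p n y y',
        z \<oplus>\<^bsub>Fp p\<^esub> z' \<oplus>\<^bsub>Fp p\<^esub> vec_dot p n x y' \<oplus>\<^bsub>Fp p\<^esub> vec_carry p n y y')),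
     one = (vec_zero p n, vec_zero p n, \<zero>\<^bsub>Fp p\<^esub>)\<rparr>"

definition center :: "('a, 'b) monoid_scheme \<Rightarrow> 'a set"
  where "center G = {c \<in> carrier G. \<forall>g\<in>carrier G. c \<otimes>\<^bsub>G\<^esub> g = g \<otimes>\<^bsub>G\<^esub> c}"

definition vertical :: "nat \<Rightarrow> nat \<Rightarrow> triple set"
  where "vertical p n = {(vec_zero p n, vec_zero p n, z) | z. z \<in> carrier (Fp p)}"

definition is_brick :: "nat \<Rightarrow> nat \<Rightarrow> triple set \<Rightarrow> bool"
  where "is_brick p n B \<longleftrightarrow>
    (\<exists>X Y Z.
      (\<forall>i\<in>{1..n}. X i \<subseteq> carrier (Fp p) \<and> X i \<noteq> {}) \<and>
      (\<forall>i\<in>{1..n}. Y i \<subseteq> carrier (Fp p) \<and> Y i \<noteq> {}) \<and>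
      Z \<subseteq> carrier (Fp p) \<and> Z \<noteq> {} \<and>
      B = {(x, y, z). x \<in> (\<Pi>\<^sub>E i\<in>{1..n}. X i) \<and> y \<in> (\<Pi>\<^sub>E i\<in>{1..n}. Y i) \<and> z \<in> Z})"

end

theory Submission
  imports Defs "HOL-Analysis.Convex" "HOL-Library.Real_Mod"
begin

text \<open>
  Write the brick as \<open>X \<times> Y \<times> Z\<close>; only this product form is needed, and both groups multiply as
  \<open>[x + x', y + y', z + z' + \<langle>x, y'\<rangle> + \<kappa>(y, y')]\<close> with \<open>\<kappa>\<close> symmetric. Let \<open>X\<^sub>a\<close> be the set of \<open>x \<in> X\<close>
  with \<open>a - x \<in> X\<close>, and likewise \<open>Y\<^sub>b\<close>. For fixed \<open>b\<close> the twist depends on \<open>y' \<in> Y\<^sub>b\<close> alone, so it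
  only contributes unimodular weights to the character sums counting solutions of
  \<open>\<langle>x, y'\<rangle> + \<kappa>(b - y', y') = c\<close> over \<open>X\<^sub>a \<times> Y\<^sub>b\<close>, and Cauchy-Schwarz with Parseval gives a solution for
  every \<open>c\<close> as soon as \<open>|X\<^sub>a||Y\<^sub>b| > p\<^bsup>n+2\<^esup>\<close>. Then the whole coset over \<open>(a, b)\<close> lies in \<open>B \<cdot> B\<close>.

  With \<open>M = |X||Y|\<close>, the sum of \<open>|X\<^sub>a||Y\<^sub>b|\<close> over all \<open>(a, b)\<close> is \<open>M\<^sup>2\<close> and each term is at most \<open>M\<close>,
  so at least \<open>M - p\<^bsup>3n+2\<^esup>/M \<ge> M(1 - 1/p)\<close> pairs are good, the last step because \<open>M\<^sup>2 \<ge> p\<^bsup>3n+3\<^esup>\<close> for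
  \<open>n \<ge> 1/\<epsilon>\<close>. This is at least \<open>|B|/p\<close> unless \<open>Z\<close> is the whole field; in that case every
  \<open>(a, b) \<in> (X + X) \<times> (Y + Y)\<close> is good.
\<close>

section \<open>Additive characters\<close>

text \<open>Taken on all integers rather than on residues, so exponents add and scale without
  reduction; the modulus returns through \<open>add_char_eq_1_iff\<close>.\<close>

definition add_char :: "nat \<Rightarrow> int \<Rightarrow> complex"
  where "add_char p k = cis (2 * pi * of_int k / of_nat p)"

lemma add_char_0 [simp]: "add_char p 0 = 1"
  by (simp add: add_char_def)

lemma add_char_add: "add_char p (k + l) = add_char p k * add_char p l"
  by (simp add: add_char_def cis_mult add_divide_distrib distrib_left)

lemma cnj_add_char: "cnj (add_char p k) = add_char p (- k)"
  by (simp add: add_char_def cis_cnj)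

lemma add_char_sum: "add_char p (sum f A) = (\<Prod>i\<in>A. add_char p (f i))"
  by (induction A rule: infinite_finite_induct) (simp_all add: add_char_add)

lemma add_char_mult_of_nat: "add_char p (int t * k) = add_char p k ^ t"
  by (simp add: add_char_def DeMoivre mult_ac)

lemma add_char_eq_1_iff:
  assumes "p > 0"
  shows "add_char p k = 1 \<longleftrightarrow> int p dvd k"
proof -
  have "2 * pi * of_int k / of_nat p = of_int m * (2 * pi) \<longleftrightarrow> k = m * int p" for m
  proof -
    have "2 * pi * of_int k / of_nat p = of_int m * (2 * pi) \<longleftrightarrow>
        (of_int k :: real) = of_int (m * int p)"
      using assms by (simp add: field_simps)
    then show ?thesis by (simp only: of_int_eq_iff)
  qed
  then show ?thesis
    unfolding add_char_def cis_eq_1_iff by (auto simp: dvd_def mult.commute)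
qed

text \<open>Unless every term is 1, this is a full geometric progression whose ratio is a nontrivial
  \<open>p\<close>-th root of unity.\<close>

lemma sum_add_char:
  assumes "p > 0"
  shows "(\<Sum>t<p. add_char p (int t * k)) = (if int p dvd k then of_nat p else 0)"
proof (cases "int p dvd k")
  case True
  then show ?thesis
    using assms add_char_eq_1_iff[of p k] by (simp add: add_char_mult_of_nat)
next
  case False
  have "add_char p k ^ p = 1"
    using assms by (simp add: add_char_eq_1_iff flip: add_char_mult_of_nat)
  then show ?thesis
    using False assms add_char_eq_1_iff[of p k] by (simp add: add_char_mult_of_nat geometric_sum)
qed

lemma sum_add_char_residues:
  assumes "p > 0"
  shows "(\<Sum>x\<in>{0..int p - 1}. add_char p (x * k)) = (if int p dvd k then of_nat p else 0)"
proof -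
  have "{0..int p - 1} = int ` {..<p}"
    using image_int_atLeastLessThan[of 0 p] by (auto simp: lessThan_atLeast0)
  then have "(\<Sum>x\<in>{0..int p - 1}. add_char p (x * k)) = (\<Sum>t<p. add_char p (int t * k))"
    by (simp add: sum.reindex)
  then show ?thesis
    using sum_add_char[OF assms] by simp
qed

section \<open>Vectors over the prime field\<close>

lemma Fp_simps:
  "carrier (Fp p) = {0..int p - 1}" "a \<oplus>\<^bsub>Fp p\<^esub> b = (a + b) mod int p"
  "a \<otimes>\<^bsub>Fp p\<^esub> b = (a * b) mod int p" "\<zero>\<^bsub>Fp p\<^esub> = 0"
  by (simp_all add: residue_ring_def)

lemma vecs_eq: "vecs p n = {1..n} \<rightarrow>\<^sub>E {0..int p - 1}"
  by (simp add: vecs_def Fp_simps)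

lemma finite_vecs [simp]: "finite (vecs p n)"
  by (auto simp: vecs_eq intro: finite_PiE)

lemma card_vecs: "card (vecs p n) = p ^ n"
  by (simp add: vecs_eq card_PiE)

lemma vecs_nth: "x \<in> vecs p n \<Longrightarrow> i \<in> {1..n} \<Longrightarrow> 0 \<le> x i \<and> x i < int p"
  by (fastforce simp: vecs_eq PiE_def Pi_def)

lemma vecs_nth_mod: "x \<in> vecs p n \<Longrightarrow> i \<in> {1..n} \<Longrightarrow> x i mod int p = x i"
  using vecs_nth[of x p n i] by simp

lemma vecs_eqI:
  assumes "x \<in> vecs p n" "y \<in> vecs p n"
    and "\<And>i. i \<in> {1..n} \<Longrightarrow> x i mod int p = y i mod int p"
  shows "x = y"
proof (rule PiE_ext)
  show "x \<in> {1..n} \<rightarrow>\<^sub>E {0..int p - 1}" "y \<in> {1..n} \<rightarrow>\<^sub>E {0..int p - 1}"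
    using assms(1,2) by (simp_all add: vecs_eq)
  show "x i = y i" if "i \<in> {1..n}" for i
    using assms(3)[OF that] vecs_nth_mod[OF assms(1) that] vecs_nth_mod[OF assms(2) that] by simp
qed

text \<open>The integer lift of \<open>vec_dot\<close>: bilinearity becomes plain ring algebra, with
  reduction mod \<open>p\<close> postponed to the end.\<close>

definition int_dot :: "nat \<Rightarrow> (nat \<Rightarrow> int) \<Rightarrow> (nat \<Rightarrow> int) \<Rightarrow> int"
  where "int_dot n x y = (\<Sum>i=1..n. x i * y i)"

lemma vec_dot_eq_int_dot:
  assumes "p > 1"
  shows "vec_dot p n x y = int_dot n x y mod int p"
proof -
  interpret residues "int p" "Fp p"
    using assms by unfold_locales simp_all
  show ?thesis
    unfolding vec_dot_def int_dot_def Fp_simps(3) by (rule sum_cong) simp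
qed

lemma vec_add_nth: "i \<in> {1..n} \<Longrightarrow> vec_add p n x y i = (x i + y i) mod int p"
  by (simp add: vec_add_def Fp_simps)

lemma vec_add_closed: "p > 0 \<Longrightarrow> vec_add p n x y \<in> vecs p n"
  by (auto simp: vec_add_def vecs_eq Fp_simps)

lemma vec_add_commute: "vec_add p n x y = vec_add p n y x"
  by (simp add: vec_add_def Fp_simps add.commute)

lemma vec_add_left_cancel:
  assumes "y \<in> vecs p n" "y' \<in> vecs p n" "vec_add p n x y = vec_add p n x y'"
  shows "y = y'"
proof (rule vecs_eqI[OF assms(1,2)])
  fix i assume i: "i \<in> {1..n}"
  have "(x i + y i) mod int p = (x i + y' i) mod int p"
    using arg_cong[OF assms(3), of "\<lambda>f. f i"] i by (simp add: vec_add_nth)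
  then have "(x i + y i - x i) mod int p = (x i + y' i - x i) mod int p"
    by (rule mod_diff_cong) simp
  then show "y i mod int p = y' i mod int p" by simp
qed

lemma vec_zero_closed: "p > 0 \<Longrightarrow> vec_zero p n \<in> vecs p n"
  by (auto simp: vec_zero_def vecs_eq Fp_simps)

lemma vec_zero_nth: "i \<in> {1..n} \<Longrightarrow> vec_zero p n i = 0"
  by (simp add: vec_zero_def Fp_simps)

lemma int_dot_vec_zero: "int_dot n (vec_zero p n) y = 0" "int_dot n y (vec_zero p n) = 0"
  by (simp_all add: int_dot_def vec_zero_nth)

lemma vec_add_vec_zero:
  assumes "p > 0" "x \<in> vecs p n"
  shows "vec_add p n (vec_zero p n) x = x" "vec_add p n x (vec_zero p n) = x"
  using assms by (auto intro!: vecs_eqI[OF vec_add_closed] simp: vec_add_nth vec_zero_nth)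

section \<open>Exponential sums of the twisted dot product\<close>

lemma sum_add_char_int_dot:
  assumes "p > 0"
  shows "(\<Sum>x\<in>vecs p n. add_char p (int_dot n x d)) =
    (if \<forall>i\<in>{1..n}. int p dvd d i then of_nat (p ^ n) else 0)"
proof -
  \<comment> \<open>The character turns the sum over coordinates into a product, so the sum over the
    box factors into one-dimensional sums.\<close>
  have "(\<Sum>x\<in>vecs p n. add_char p (int_dot n x d)) =
      (\<Sum>x\<in>{1..n} \<rightarrow>\<^sub>E {0..int p - 1}. \<Prod>i\<in>{1..n}. add_char p (x i * d i))"
    by (simp add: vecs_eq int_dot_def add_char_sum)
  also have "\<dots> = (\<Prod>i\<in>{1..n}. \<Sum>x\<in>{0..int p - 1}. add_char p (x * d i))"
    by (subst prod_sum_PiE) simp_all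
  also have "\<dots> = (\<Prod>i\<in>{1..n}. if int p dvd d i then of_nat p else 0)"
    using assms by (simp add: sum_add_char_residues)
  also have "\<dots> = (if \<forall>i\<in>{1..n}. int p dvd d i then of_nat (p ^ n) else 0)"
  proof (cases "\<forall>i\<in>{1..n}. int p dvd d i")
    case True
    then have "(\<Prod>i\<in>{1..n}. if int p dvd d i then of_nat p else (0::complex)) = (\<Prod>i\<in>{1..n}. of_nat p)"
      by (intro prod.cong) auto
    then show ?thesis using True by simp
  next
    case False
    then show ?thesis by auto
  qed
  finally show ?thesis .
qed

lemma int_dot_diff_right: "int_dot n x y - int_dot n x y' = int_dot n x (\<lambda>i. y i - y' i)"
  by (simp add: int_dot_def sum_subtractf right_diff_distrib)

lemma int_dot_scale_right: "c * int_dot n x y = int_dot n x (\<lambda>i. c * y i)"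
  by (simp add: int_dot_def sum_distrib_left mult_ac)

text \<open>Expanding the square gives a sum over pairs \<open>y\<close>, \<open>y'\<close> with
  weights of modulus 1. Orthogonality in \<open>x\<close> kills the pairs with
  \<open>y \<noteq> y'\<close>, and on the diagonal the weight is 1, so an arbitrary
  \<open>g\<close> leaves the total unchanged.\<close>

lemma Parseval_twisted:
  assumes p: "prime p" and t: "0 < t" "t < p" and Y: "Y \<subseteq> vecs p n"
  shows "(\<Sum>x\<in>vecs p n. (norm (\<Sum>y\<in>Y. add_char p (int t * (int_dot n x y + g y))))\<^sup>2) =
    real (p ^ n) * real (card Y)"
proof -
  have p0: "p > 0" using p by (simp add: prime_gt_0_nat)
  have finY: "finite Y" using finite_subset[OF Y] by simp
  define S where "S x = (\<Sum>y\<in>Y. add_char p (int t * (int_dot n x y + g y)))" for x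
  define d where "d y y' i = int t * (y i - y' i)" for y y' :: "nat \<Rightarrow> int" and i :: nat
  have dvd: "(\<forall>i\<in>{1..n}. int p dvd d y y' i) \<longleftrightarrow> y = y'" if "y \<in> Y" "y' \<in> Y" for y y'
  proof
    assume *: "\<forall>i\<in>{1..n}. int p dvd d y y' i"
    \<comment> \<open>Since \<open>p\<close> is prime, \<open>t\<close> is invertible mod
      \<open>p\<close>, and divisibility passes from \<open>d y y'\<close> to the coordinates of
      \<open>y - y'\<close>.\<close>
    have "\<not> int p dvd int t" using t by (auto dest: dvd_imp_le)
    then have "int p dvd y i - y' i" if "i \<in> {1..n}" for i
      using * that p by (auto simp: d_def prime_dvd_mult_iff)
    then show "y = y'"
      using that Y by (intro vecs_eqI[of y p n y']) (auto simp: mod_eq_dvd_iff)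
  qed (simp add: d_def)
  have "complex_of_real (\<Sum>x\<in>vecs p n. (norm (S x))\<^sup>2) = (\<Sum>x\<in>vecs p n. S x * cnj (S x))"
    by (simp only: of_real_sum complex_norm_square)
  also have "\<dots> = (\<Sum>x\<in>vecs p n. \<Sum>y\<in>Y. \<Sum>y'\<in>Y.
      add_char p (int t * (g y - g y')) * add_char p (int_dot n x (d y y')))"
  proof (intro sum.cong refl)
    fix x
    have "add_char p (int t * (int_dot n x y + g y)) * cnj (add_char p (int t * (int_dot n x y' + g y')))
        = add_char p (int t * (g y - g y')) * add_char p (int_dot n x (d y y'))" for y y'
    proof -
      have "int_dot n x (d y y') = int t * (int_dot n x y - int_dot n x y')"
        by (simp add: int_dot_diff_right int_dot_scale_right d_def [abs_def])
      then have "int t * (int_dot n x y + g y) + - (int t * (int_dot n x y' + g y')) =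
          int t * (g y - g y') + int_dot n x (d y y')"
        by (simp only:) (simp add: algebra_simps)
      then show ?thesis
        by (simp only: cnj_add_char flip: add_char_add)
    qed
    then show "S x * cnj (S x) = (\<Sum>y\<in>Y. \<Sum>y'\<in>Y.
        add_char p (int t * (g y - g y')) * add_char p (int_dot n x (d y y')))"
      by (simp add: S_def sum_product)
  qed
  also have "\<dots> = (\<Sum>y\<in>Y. \<Sum>x\<in>vecs p n. \<Sum>y'\<in>Y.
      add_char p (int t * (g y - g y')) * add_char p (int_dot n x (d y y')))"
    by (rule sum.swap)
  also have "\<dots> = (\<Sum>y\<in>Y. \<Sum>y'\<in>Y.
      add_char p (int t * (g y - g y')) * (\<Sum>x\<in>vecs p n. add_char p (int_dot n x (d y y'))))"
    by (subst sum.swap[where A = "vecs p n"]) (simp add: sum_distrib_left)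
  also have "\<dots> = (\<Sum>y\<in>Y. \<Sum>y'\<in>Y.
      add_char p (int t * (g y - g y')) * (if y = y' then of_nat (p ^ n) else 0))"
    using dvd by (intro sum.cong refl) (simp add: sum_add_char_int_dot[OF p0])
  also have "\<dots> = (\<Sum>y\<in>Y. \<Sum>y'\<in>Y. if y = y' then of_nat (p ^ n) else 0)"
    by (intro sum.cong refl) simp
  also have "\<dots> = of_nat (p ^ n) * of_nat (card Y)"
    using finY by simp
  finally have "complex_of_real (\<Sum>x\<in>vecs p n. (norm (S x))\<^sup>2) =
      complex_of_real (real (p ^ n) * real (card Y))"
    by simp
  then show ?thesis
    unfolding S_def by (simp only: of_real_eq_iff)
qed

text \<open>Solutions are counted by averaging characters over the frequencies \<open>t < p\<close>.
  Frequency 0 contributes |X||Y|, every other one at most the square root of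
  |X||Y|\<open>p^n\<close>; a missed residue would therefore force |X||Y| \<le>
  \<open>p^(n+2)\<close>.\<close>

lemma int_dot_plus_covers_residues:
  assumes p: "prime p" and X: "X \<subseteq> vecs p n" and Y: "Y \<subseteq> vecs p n"
    and large: "card X * card Y > p ^ (n + 2)"
  shows "\<exists>x\<in>X. \<exists>y\<in>Y. (int_dot n x y + g y) mod int p = c mod int p"
proof (rule ccontr)
  assume none: "\<not> ?thesis"
  have p0: "p > 0" using p by (simp add: prime_gt_0_nat)
  \<comment> \<open>Moving the target to 0 turns a solution into divisibility by \<open>p\<close>,
    which is what summation over \<open>t\<close> detects.\<close>
  define h where "h y = g y - c" for y
  define S where "S t x = (\<Sum>y\<in>Y. add_char p (int t * (int_dot n x y + h y)))" for t x
  define Q where "Q = real (card X) * real (card Y)"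
  define R where "R = sqrt (Q * real (p ^ n))"
  have bound: "norm (\<Sum>x\<in>X. S t x) \<le> R" if t: "0 < t" "t < p" for t
  proof -
    \<comment> \<open>Cauchy-Schwarz over \<open>X\<close>; the sum of squares is then enlarged to
      the whole space, where Parseval is exact.\<close>
    have "(\<Sum>x\<in>X. norm (S t x))\<^sup>2 \<le> (\<Sum>x\<in>X. (norm (S t x))\<^sup>2) * real (card X)"
      by (rule sum_squared_le_sum_of_squares)
    also have "\<dots> \<le> (\<Sum>x\<in>vecs p n. (norm (S t x))\<^sup>2) * real (card X)"
      using X by (intro mult_right_mono sum_mono2) auto
    also have "\<dots> = Q * real (p ^ n)"
      using Parseval_twisted[OF p t Y, of h] by (simp add: S_def Q_def)
    finally have "(\<Sum>x\<in>X. norm (S t x)) \<le> R"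
      unfolding R_def by (rule real_le_rsqrt)
    then show ?thesis using norm_sum[of "S t" X] by linarith
  qed
  have "(\<Sum>t<p. \<Sum>x\<in>X. S t x) =
      (\<Sum>x\<in>X. \<Sum>t<p. S t x)" by (rule sum.swap)
  also have "\<dots> = (\<Sum>x\<in>X. \<Sum>y\<in>Y. \<Sum>t<p. add_char p (int t * (int_dot n x y + h y)))"
    unfolding S_def by (intro sum.cong refl sum.swap)
  also have "\<dots> = 0"
  proof (rule sum.neutral, rule ballI, rule sum.neutral, rule ballI)
    fix x y assume "x \<in> X" "y \<in> Y"
    then have "\<not> int p dvd int_dot n x y + h y"
      using none by (auto simp: h_def mod_eq_dvd_iff algebra_simps)
    then show "(\<Sum>t<p. add_char p (int t * (int_dot n x y + h y))) = 0"
      by (simp add: sum_add_char[OF p0])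
  qed
  finally have zero: "(\<Sum>t<p. \<Sum>x\<in>X. S t x) = 0" .
  \<comment> \<open>The main term \<open>Q\<close> sits at frequency 0, and the remaining
    frequencies have to cancel it.\<close>
  have "(\<Sum>t<p. \<Sum>x\<in>X. S t x) = (\<Sum>x\<in>X. S 0 x) + (\<Sum>t\<in>{1..<p}. \<Sum>x\<in>X. S t x)"
    using p0 by (simp add: lessThan_atLeast0 sum.atLeast_Suc_lessThan)
  moreover have "(\<Sum>x\<in>X. S 0 x) = of_real Q" by (simp add: S_def Q_def)
  ultimately have "of_real Q = - (\<Sum>t\<in>{1..<p}. \<Sum>x\<in>X. S t x)"
    using zero by (simp add: eq_neg_iff_add_eq_0)
  then have "norm (complex_of_real Q) = norm (\<Sum>t\<in>{1..<p}. \<Sum>x\<in>X. S t x)" by simp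
  moreover have "norm (complex_of_real Q) = Q" by (simp only: norm_of_real) (simp add: Q_def)
  ultimately have "Q \<le> (\<Sum>t\<in>{1..<p}. norm (\<Sum>x\<in>X. S t x))"
    using norm_sum[of "\<lambda>t. \<Sum>x\<in>X. S t x" "{1..<p}"] by simp
  also have "\<dots> \<le> (\<Sum>t\<in>{1..<p}. R)"
    by (intro sum_mono bound) auto
  \<comment> \<open>The \<open>p - 1\<close> frequencies are rounded up to \<open>p\<close>; after
    squaring, this yields the threshold \<open>p^(n+2)\<close>.\<close>
  also have "\<dots> \<le> real p * R"
    by (auto simp: R_def Q_def intro!: mult_right_mono)
  finally have "Q\<^sup>2 \<le> (real p * R)\<^sup>2"
    by (intro power_mono) (auto simp: Q_def)
  also have "\<dots> = Q * real (p ^ (n + 2))"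
    by (simp add: R_def power_mult_distrib Q_def power_add mult_ac power2_eq_square)
  finally have "Q * Q \<le> Q * real (p ^ (n + 2))" by (simp add: power2_eq_square)
  moreover have "real (p ^ (n + 2)) < Q"
    using large unfolding Q_def of_nat_mult [symmetric] of_nat_less_iff by simp
  moreover have "0 < Q" using calculation(2) by (smt (verit) of_nat_0_le_iff)
  ultimately show False by simp
qed


section \<open>Popular sums\<close>

text \<open>The set \<open>X\<^sub>a\<close>. As \<open>vec_add\<close> commutes, its members serve
  as left or right summands: \<open>x\<close> is taken on the left, \<open>y'\<close> on the
  right.\<close>

definition summands :: "nat \<Rightarrow> nat \<Rightarrow> (nat \<Rightarrow> int) set \<Rightarrow> (nat \<Rightarrow> int) \<Rightarrow> (nat \<Rightarrow> int) set"
  where "summands p n X a = {x \<in> X. \<exists>x'\<in>X. vec_add p n x x' = a}"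

lemma card_translate:
  assumes "X \<subseteq> vecs p n"
  shows "card (vec_add p n x ` X) = card X"
proof (rule card_image, rule inj_onI)
  fix y y' assume "y \<in> X" "y' \<in> X" "vec_add p n x y = vec_add p n x y'"
  then show "y = y'" using assms vec_add_left_cancel by blast
qed

text \<open>Double counting: each \<open>x\<close> belongs to \<open>X\<^sub>a\<close> for exactly
  the |X| values \<open>a\<close> in the translate of \<open>X\<close> by \<open>x\<close>.\<close>

lemma sum_card_summands:
  assumes "p > 0" "X \<subseteq> vecs p n"
  shows "(\<Sum>a\<in>vecs p n. card (summands p n X a)) = card X * card X"
proof -
  have "finite X" using assms(2) finite_subset finite_vecs by blast
  moreover have "{a \<in> vecs p n. \<exists>x'\<in>X. vec_add p n x x' = a} = vec_add p n x ` X" for x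
    using vec_add_closed[OF assms(1)] by auto
  ultimately show ?thesis
    unfolding summands_def
    by (subst sum_multicount_gen[where k = "\<lambda>_. card X"]) (simp_all add: card_translate[OF assms(2)])
qed

text \<open>The total weight is split at the threshold \<open>K\<close>: a pair in \<open>T\<close>
  weighs at most |X||Y|, and each of the at most \<open>p^(2n)\<close> other pairs weighs at most
  \<open>K\<close>.\<close>

lemma card_popular_pairs:
  fixes K :: nat
  assumes p: "p > 0" and X: "X \<subseteq> vecs p n" and Y: "Y \<subseteq> vecs p n"
  defines "T \<equiv> {(a, b) \<in> vecs p n \<times> vecs p n. K < card (summands p n X a) * card (summands p n Y b)}"
  shows "(card X * card Y)\<^sup>2 \<le> card T * (card X * card Y) + p ^ (2 * n) * K"
proof -
  let ?V = "vecs p n"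
  define w where "w = (\<lambda>(a, b). card (summands p n X a) * card (summands p n Y b))"
  have fin: "finite X" "finite Y" using X Y finite_subset finite_vecs by blast+
  have T: "T \<subseteq> ?V \<times> ?V" by (auto simp: T_def)
  have w_le: "w ab \<le> card X * card Y" for ab
    unfolding w_def
    by (auto simp: summands_def fin split: prod.splits intro!: mult_mono card_mono)
  have "(card X * card Y)\<^sup>2 = (card X * card X) * (card Y * card Y)"
    by (simp add: power2_eq_square)
  also have "\<dots> = (\<Sum>ab\<in>?V \<times> ?V. w ab)"
    by (simp add: sum_card_summands[OF p X, symmetric] sum_card_summands[OF p Y, symmetric]
        sum_product sum.cartesian_product w_def)
  also have "\<dots> = (\<Sum>ab\<in>T. w ab) + (\<Sum>ab\<in>?V \<times> ?V - T. w ab)"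
    using T by (subst sum.subset_diff[OF T]) simp_all
  also have "(\<Sum>ab\<in>T. w ab) \<le> card T * (card X * card Y)"
    using sum_bounded_above[of T w "card X * card Y"] w_le by simp
  also have "(\<Sum>ab\<in>?V \<times> ?V - T. w ab) \<le> card (?V \<times> ?V - T) * K"
    using sum_bounded_above[of "?V \<times> ?V - T" w K] by (force simp: T_def w_def)
  also have "\<dots> \<le> p ^ (2 * n) * K"
    using card_mono[of "?V \<times> ?V" "?V \<times> ?V - T"]
    by (intro mult_right_mono) (simp_all add: card_vecs card_cartesian_product power_add mult_2)
  finally show ?thesis by simp
qed

section \<open>The two extra special groups as one family\<close>

definition twisted_group :: "nat \<Rightarrow> nat \<Rightarrow> ((nat \<Rightarrow> int) \<Rightarrow> (nat \<Rightarrow> int) \<Rightarrow> int) \<Rightarrow> triple monoid"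
  where "twisted_group p n \<kappa> =
    \<lparr>carrier = vecs p n \<times> vecs p n \<times> carrier (Fp p),
     monoid.mult = (\<lambda>(x, y, z) (x', y', z').
       (vec_add p n x x', vec_add p n y y',
        z \<oplus>\<^bsub>Fp p\<^esub> z' \<oplus>\<^bsub>Fp p\<^esub> vec_dot p n x y' \<oplus>\<^bsub>Fp p\<^esub> \<kappa> y y')),
     one = (vec_zero p n, vec_zero p n, \<zero>\<^bsub>Fp p\<^esub>)\<rparr>"

lemma heis_group_eq_twisted: "heis_group p n = twisted_group p n (\<lambda>_ _. 0)"
  by (simp add: heis_group_def twisted_group_def Fp_simps)

lemma carry_group_eq_twisted: "carry_group p n = twisted_group p n (vec_carry p n)"
  by (simp add: carry_group_def twisted_group_def)

lemma vec_carry_commute: "vec_carry p n y y' = vec_carry p n y' y"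
  by (simp add: vec_carry_def add.commute)

lemma vec_carry_vec_zero:
  assumes "y \<in> vecs p n"
  shows "vec_carry p n (vec_zero p n) y = 0"
proof -
  have "(vec_zero p n i + y i) div int p = 0" if "i \<in> {1..n}" for i
    using vecs_nth[OF assms that] that by (simp add: vec_zero_nth)
  then show ?thesis by (simp add: vec_carry_def)
qed

text \<open>Symmetry makes the twist cancel when two elements are multiplied in both orders;
  vanishing at the zero vector lets vertical elements act by translating the last coordinate
  alone.\<close>

locale symmetric_twist =
  fixes p n :: nat and \<kappa> :: "(nat \<Rightarrow> int) \<Rightarrow> (nat \<Rightarrow> int) \<Rightarrow> int"
  assumes prime_p: "prime p"
    and \<kappa>_commute: "\<kappa> y y' = \<kappa> y' y"
    and \<kappa>_vec_zero: "y \<in> vecs p n \<Longrightarrow> \<kappa> (vec_zero p n) y = 0"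
begin

abbreviation "G \<equiv> twisted_group p n \<kappa>"

lemma p_gt_1: "p > 1" and p_gt_0: "p > 0"
  using prime_p prime_gt_1_nat prime_gt_0_nat by auto

lemma G_carrier: "carrier G = vecs p n \<times> vecs p n \<times> {0..int p - 1}"
  by (simp add: twisted_group_def Fp_simps)

lemma G_mult: "(x, y, z) \<otimes>\<^bsub>G\<^esub> (x', y', z') =
  (vec_add p n x x', vec_add p n y y', (z + z' + int_dot n x y' + \<kappa> y y') mod int p)"
  by (simp add: twisted_group_def Fp_simps vec_dot_eq_int_dot[OF p_gt_1] mod_simps)

lemma G_one: "\<one>\<^bsub>G\<^esub> = (vec_zero p n, vec_zero p n, 0)"
  by (simp add: twisted_group_def Fp_simps)

section \<open>The vertical subgroup as the center\<close>

lemma vertical_eq: "vertical p n = {vec_zero p n} \<times> {vec_zero p n} \<times> {0..int p - 1}"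
  by (auto simp: vertical_def Fp_simps)

lemma vertical_mult:
  assumes "x \<in> vecs p n" "y \<in> vecs p n"
  shows "(vec_zero p n, vec_zero p n, z) \<otimes>\<^bsub>G\<^esub> (x, y, z') = (x, y, (z + z') mod int p)"
    and "(x, y, z') \<otimes>\<^bsub>G\<^esub> (vec_zero p n, vec_zero p n, z) = (x, y, (z + z') mod int p)"
  using assms p_gt_0 \<kappa>_vec_zero[of y] \<kappa>_commute[of y "vec_zero p n"]
  by (simp_all add: G_mult vec_add_vec_zero int_dot_vec_zero add.commute)

lemma order_G: "order G = p ^ (2 * n + 1)"
  by (simp add: order_def G_carrier card_cartesian_product card_vecs power_add mult_2)

lemma vertical_nontrivial: "vertical p n \<noteq> {\<one>\<^bsub>G\<^esub>}"
proof -
  have "(vec_zero p n, vec_zero p n, 1) \<in> vertical p n"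
    using p_gt_1 by (simp add: vertical_eq)
  then show ?thesis by (auto simp: G_one)
qed

lemma vertical_subgroup: "subgroup (vertical p n) G"
proof
  show "vertical p n \<subseteq> carrier G"
    using vec_zero_closed[OF p_gt_0] by (auto simp: vertical_eq G_carrier)
  show "\<one>\<^bsub>G\<^esub> \<in> vertical p n"
    using p_gt_0 by (simp add: G_one vertical_eq)
  fix u assume "u \<in> vertical p n"
  then obtain z where u: "u = (vec_zero p n, vec_zero p n, z)" and z: "z \<in> {0..int p - 1}"
    by (auto simp: vertical_eq)
  show "u \<otimes>\<^bsub>G\<^esub> v \<in> vertical p n" if "v \<in> vertical p n" for v
    using that p_gt_0 vec_zero_closed[OF p_gt_0]
    by (auto simp: vertical_eq u vertical_mult)
  define v where "v = (vec_zero p n, vec_zero p n, (- z) mod int p)"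
  have v: "v \<in> vertical p n" using p_gt_0 by (simp add: v_def vertical_eq)
  \<comment> \<open>Group axioms for \<open>G\<close> are not at hand here, so the inverse is
    computed from its definite description, with existence and uniqueness checked in
    coordinates.\<close>
  have "inv\<^bsub>G\<^esub> u = v"
    unfolding m_inv_def
  proof (rule the_equality)
    show "v \<in> carrier G \<and> u \<otimes>\<^bsub>G\<^esub> v = \<one>\<^bsub>G\<^esub> \<and> v \<otimes>\<^bsub>G\<^esub> u = \<one>\<^bsub>G\<^esub>"
      using vec_zero_closed[OF p_gt_0] p_gt_0
      by (simp add: u v_def vertical_mult G_carrier G_one mod_simps)
    fix v' assume v': "v' \<in> carrier G \<and> u \<otimes>\<^bsub>G\<^esub> v' = \<one>\<^bsub>G\<^esub> \<and> v' \<otimes>\<^bsub>G\<^esub> u = \<one>\<^bsub>G\<^esub>"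
    obtain x' y' z' where v'_eq: "v' = (x', y', z')" by (cases v')
    have "x' = vec_zero p n" "y' = vec_zero p n" "(z + z') mod int p = 0" "z' \<in> {0..int p - 1}"
      using v' by (auto simp: u v'_eq vertical_mult G_carrier G_one)
    moreover have "(- z) mod int p = (z + z' - z) mod int p"
      using mod_diff_cong[of "0" "int p" "z + z'" z z] calculation(3) by simp
    ultimately show "v' = v" by (simp add: v_def v'_eq)
  qed
  then show "inv\<^bsub>G\<^esub> u \<in> vertical p n" using v by simp
qed

text \<open>Once the symmetric twist cancels, commuting with (x', y', 0) says that <x, y'> and <x',
  y> agree mod \<open>p\<close>, and this alternating form is nondegenerate.\<close>

lemma vertical_eq_center: "vertical p n = center G"
proof
  show "vertical p n \<subseteq> center G"
    using vec_zero_closed[OF p_gt_0]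
    by (auto simp: center_def vertical_eq G_carrier vertical_mult)
  show "center G \<subseteq> vertical p n"
  proof
    fix u assume u: "u \<in> center G"
    obtain x y z where u_eq: "u = (x, y, z)" by (cases u)
    have xyz: "x \<in> vecs p n" "y \<in> vecs p n" "z \<in> {0..int p - 1}"
      using u by (auto simp: center_def u_eq G_carrier)
    have comm: "int_dot n x y' mod int p = int_dot n x' y mod int p"
      if "x' \<in> vecs p n" "y' \<in> vecs p n" for x' y'
    proof -
      have "(x', y', 0) \<in> carrier G" using that p_gt_0 by (simp add: G_carrier)
      then have "(x, y, z) \<otimes>\<^bsub>G\<^esub> (x', y', 0) = (x', y', 0) \<otimes>\<^bsub>G\<^esub> (x, y, z)"
        using u by (simp add: center_def u_eq)
      then have "(z + int_dot n x y' + \<kappa> y y') mod int p = (z + int_dot n x' y + \<kappa> y y') mod int p"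
        by (simp add: G_mult \<kappa>_commute[of y' y])
      then have "(z + int_dot n x y' + \<kappa> y y' - (z + \<kappa> y y')) mod int p =
          (z + int_dot n x' y + \<kappa> y y' - (z + \<kappa> y y')) mod int p"
        by (rule mod_diff_cong) simp
      then show ?thesis by simp
    qed
    \<comment> \<open>Standard basis vectors: testing against (0, \<open>e i\<close>) reads off
      \<open>x i\<close>, testing against (\<open>e i\<close>, 0) reads off
      \<open>y i\<close>.\<close>
    define e where "e j = (\<lambda>i\<in>{1..n}. if i = j then 1 else 0 :: int)" for j
    have e: "e j \<in> vecs p n" for j using p_gt_1 by (auto simp: e_def vecs_eq)
    have dot_e: "int_dot n v (e j) = v j" "int_dot n (e j) v = v j" if "j \<in> {1..n}" for v j
      using that by (simp_all add: int_dot_def e_def if_distrib if_distribR cong: if_cong)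
    have "x = vec_zero p n"
    proof (rule vecs_eqI[OF xyz(1) vec_zero_closed[OF p_gt_0]])
      fix i assume i: "i \<in> {1..n}"
      show "x i mod int p = vec_zero p n i mod int p"
        using comm[OF vec_zero_closed[OF p_gt_0] e[of i]] by (simp add: int_dot_vec_zero dot_e[OF i] vec_zero_nth[OF i])
    qed
    moreover have "y = vec_zero p n"
    proof (rule vecs_eqI[OF xyz(2) vec_zero_closed[OF p_gt_0]])
      fix i assume i: "i \<in> {1..n}"
      show "y i mod int p = vec_zero p n i mod int p"
        using comm[OF e[of i] vec_zero_closed[OF p_gt_0]] by (simp add: int_dot_vec_zero dot_e[OF i] vec_zero_nth[OF i])
    qed
    ultimately show "u \<in> vertical p n" using xyz(3) by (simp add: u_eq vertical_eq)
  qed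
qed

section \<open>Counting cosets of the center in a product set\<close>

lemma vertical_coset:
  assumes "a \<in> vecs p n" "b \<in> vecs p n" "c \<in> {0..int p - 1}"
  shows "vertical p n #>\<^bsub>G\<^esub> (a, b, c) = {a} \<times> {b} \<times> {0..int p - 1}"
proof
  show "vertical p n #>\<^bsub>G\<^esub> (a, b, c) \<subseteq> {a} \<times> {b} \<times> {0..int p - 1}"
    using assms p_gt_0 by (auto simp: r_coset_def vertical_eq vertical_mult)
  show "{a} \<times> {b} \<times> {0..int p - 1} \<subseteq> vertical p n #>\<^bsub>G\<^esub> (a, b, c)"
  proof
    fix u assume "u \<in> {a} \<times> {b} \<times> {0..int p - 1}"
    then obtain w where u: "u = (a, b, w)" and w: "w \<in> {0..int p - 1}" by auto
    have "u = (vec_zero p n, vec_zero p n, (w - c) mod int p) \<otimes>\<^bsub>G\<^esub> (a, b, c)"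
      using assms w by (simp add: u vertical_mult mod_simps)
    moreover have "(vec_zero p n, vec_zero p n, (w - c) mod int p) \<in> vertical p n"
      using p_gt_0 by (simp add: vertical_eq)
    ultimately show "u \<in> vertical p n #>\<^bsub>G\<^esub> (a, b, c)" by (auto simp: r_coset_def)
  qed
qed

text \<open>Cosets of the center are the fibres of the projection to the first two coordinates.
  These fibres are nonempty, so distinct pairs give distinct cosets, and it suffices to count pairs
  with full fibre.\<close>

lemma card_cosets_ge:
  assumes T: "T \<subseteq> vecs p n \<times> vecs p n"
    and fibres: "\<And>a b w. (a, b) \<in> T \<Longrightarrow> w \<in> {0..int p - 1} \<Longrightarrow> (a, b, w) \<in> S"
  shows "card T \<le> card {C \<in> rcosets\<^bsub>G\<^esub> (vertical p n). C \<subseteq> S}"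
proof -
  let ?f = "\<lambda>(a, b). {a} \<times> {b} \<times> {0..int p - 1}"
  have "inj_on ?f T"
  proof (rule inj_onI)
    fix u v assume eq: "?f u = ?f v"
    obtain a b where u: "u = (a, b)" by (cases u)
    have "(a, b, 0) \<in> ?f v" using p_gt_0 unfolding eq[symmetric] u by simp
    then show "u = v" by (cases v) (simp add: u)
  qed
  moreover have "?f ` T \<subseteq> {C \<in> rcosets\<^bsub>G\<^esub> (vertical p n). C \<subseteq> S}"
  proof
    fix C assume "C \<in> ?f ` T"
    then obtain a b where ab: "(a, b) \<in> T" and C: "C = {a} \<times> {b} \<times> {0..int p - 1}" by auto
    have "(a, b, 0) \<in> carrier G" using T ab p_gt_0 by (auto simp: G_carrier)
    moreover have "C = vertical p n #>\<^bsub>G\<^esub> (a, b, 0)"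
      using T ab p_gt_0 by (subst vertical_coset) (auto simp: C)
    ultimately have "C \<in> rcosets\<^bsub>G\<^esub> (vertical p n)" by (auto simp: RCOSETS_def)
    then show "C \<in> {C \<in> rcosets\<^bsub>G\<^esub> (vertical p n). C \<subseteq> S}"
      using fibres[OF ab] by (auto simp: C)
  qed
  moreover have "finite {C \<in> rcosets\<^bsub>G\<^esub> (vertical p n). C \<subseteq> S}"
    by (simp add: RCOSETS_def G_carrier)
  ultimately show ?thesis by (rule card_inj_on_le)
qed

text \<open>With \<open>b\<close> fixed, the left partner of \<open>y'\<close> is a function
  \<open>s\<close> of \<open>y'\<close>, so the twist becomes a function of \<open>y'\<close> alone
  and can take the role of \<open>g\<close> in the covering lemma.\<close>

lemma popular_fibre_full:
  assumes X: "X \<subseteq> vecs p n" and Y: "Y \<subseteq> vecs p n" and z: "z \<in> Z"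
    and large: "p ^ (n + 2) < card (summands p n X a) * card (summands p n Y b)"
    and w: "w \<in> {0..int p - 1}"
  shows "(a, b, w) \<in> (X \<times> Y \<times> Z) <#>\<^bsub>G\<^esub> (X \<times> Y \<times> Z)"
proof -
  have "\<forall>y'\<in>summands p n Y b. \<exists>y\<in>Y. vec_add p n y y' = b"
    by (auto simp: summands_def vec_add_commute)
  then obtain s where s: "\<And>y'. y' \<in> summands p n Y b \<Longrightarrow> s y' \<in> Y \<and> vec_add p n (s y') y' = b"
    by metis
  have "summands p n X a \<subseteq> vecs p n" "summands p n Y b \<subseteq> vecs p n"
    using X Y by (auto simp: summands_def)
  \<comment> \<open>A single \<open>z\<close> is used in both factors, so the target is
    \<open>w\<close> less the two copies of \<open>z\<close>.\<close>
  then obtain x y' where x: "x \<in> summands p n X a" and y': "y' \<in> summands p n Y b"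
    and eq: "(int_dot n x y' + \<kappa> (s y') y') mod int p = (w - z - z) mod int p"
    using int_dot_plus_covers_residues[OF prime_p _ _ large, of "\<lambda>y'. \<kappa> (s y') y'" "w - z - z"]
    by blast
  obtain x' where x': "x' \<in> X" "vec_add p n x x' = a"
    using x by (auto simp: summands_def)
  have "(z + z + (int_dot n x y' + \<kappa> (s y') y')) mod int p = (z + z + (w - z - z)) mod int p"
    using eq by (rule mod_add_cong[OF refl])
  then have "(x, s y', z) \<otimes>\<^bsub>G\<^esub> (x', y', z) = (a, b, w)"
    using s[OF y'] x' w by (simp add: G_mult add.assoc)
  moreover have "(x, s y', z) \<in> X \<times> Y \<times> Z" "(x', y', z) \<in> X \<times> Y \<times> Z"
    using x x' s[OF y'] y' z by (auto simp: summands_def)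
  ultimately show ?thesis unfolding set_mult_def by force
qed

text \<open>When the third coordinate is unrestricted, it can absorb both the dot product and the
  twist, so one representation of each sum is enough.\<close>

lemma sumset_fibre_full:
  assumes "x \<in> X" "x' \<in> X" "y \<in> Y" "y' \<in> Y" and w: "w \<in> {0..int p - 1}"
  defines "B \<equiv> X \<times> Y \<times> {0..int p - 1}"
  shows "(vec_add p n x x', vec_add p n y y', w) \<in> B <#>\<^bsub>G\<^esub> B"
proof -
  define z where "z = (w - int_dot n x y' - \<kappa> y y') mod int p"
  have "(x, y, z) \<otimes>\<^bsub>G\<^esub> (x', y', 0) = (vec_add p n x x', vec_add p n y y', w)"
    using w mod_add_left_eq[of "w - int_dot n x y' - \<kappa> y y'" "int p" "int_dot n x y' + \<kappa> y y'"]
    by (simp add: G_mult z_def add.assoc)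
  moreover have "(x, y, z) \<in> B" "(x', y', 0) \<in> B"
    using assms p_gt_0 by (simp_all add: B_def z_def)
  ultimately show ?thesis unfolding set_mult_def by force
qed

text \<open>Popularity yields about \<open>M(1 - 1/p)\<close> cosets, which matches
  |B|\<open>/p\<close> only if |Z| \<le> \<open>p - 1\<close>; hence the case distinction on
  \<open>Z\<close>.\<close>

lemma card_cosets_product_ge:
  assumes X: "X \<subseteq> vecs p n" "X \<noteq> {}" and Y: "Y \<subseteq> vecs p n" "Y \<noteq> {}"
    and Z: "Z \<subseteq> {0..int p - 1}" "Z \<noteq> {}"
    and large: "p ^ (3 * n + 3) \<le> (card X * card Y)\<^sup>2"
  defines "B \<equiv> X \<times> Y \<times> Z"
  shows "card B \<le> p * card {C \<in> rcosets\<^bsub>G\<^esub> (vertical p n). C \<subseteq> B <#>\<^bsub>G\<^esub> B}"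
proof -
  define M where "M = card X * card Y"
  let ?N = "card {C \<in> rcosets\<^bsub>G\<^esub> (vertical p n). C \<subseteq> B <#>\<^bsub>G\<^esub> B}"
  have card_B: "card B = M * card Z" by (simp add: B_def M_def card_cartesian_product)
  show ?thesis
  proof (cases "Z = {0..int p - 1}")
    case True
    \<comment> \<open>Translates by one fixed element already provide \<open>M\<close> pairs, and
      here |B| equals \<open>p M\<close>.\<close>
    obtain x0 y0 where xy0: "x0 \<in> X" "y0 \<in> Y" using X Y by auto
    have "card (vec_add p n x0 ` X \<times> vec_add p n y0 ` Y) \<le> ?N"
    proof (rule card_cosets_ge)
      fix a b w assume "(a, b) \<in> vec_add p n x0 ` X \<times> vec_add p n y0 ` Y" "w \<in> {0..int p - 1}"
      then show "(a, b, w) \<in> B <#>\<^bsub>G\<^esub> B"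
        using xy0 sumset_fibre_full unfolding B_def True by auto
    qed (use vec_add_closed[OF p_gt_0] in auto)
    then have "M \<le> ?N"
      using X Y by (simp add: M_def card_cartesian_product card_translate)
    then show ?thesis
      using True by (simp add: card_B)
  next
    case False
    then have "card Z < p"
      using psubset_card_mono[of "{0..int p - 1}" Z] Z by auto
    define T where "T = {(a, b) \<in> vecs p n \<times> vecs p n.
      p ^ (n + 2) < card (summands p n X a) * card (summands p n Y b)}"
    have "card T \<le> ?N"
    proof (rule card_cosets_ge)
      obtain z where "z \<in> Z" using Z by auto
      then show "(a, b, w) \<in> B <#>\<^bsub>G\<^esub> B" if "(a, b) \<in> T" "w \<in> {0..int p - 1}" for a b w
        using that popular_fibre_full[OF X(1) Y(1)] by (auto simp: B_def T_def)
    qed (auto simp: T_def)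
    have "M > 0"
      using large p_gt_0 by (cases "M = 0") (auto simp: M_def)
    \<comment> \<open>Multiplied by \<open>p\<close>, the contribution of the unpopular pairs is
      exactly the quantity that \<open>large\<close> bounds by the square of
      \<open>M\<close>.\<close>
    have "p * (p ^ (2 * n) * p ^ (n + 2)) = p ^ Suc (2 * n + (n + 2))"
      by (simp only: power_Suc power_add)
    also have "Suc (2 * n + (n + 2)) = 3 * n + 3" by simp
    finally have pow: "p * (p ^ (2 * n) * p ^ (n + 2)) = p ^ (3 * n + 3)" .
    have "p * M\<^sup>2 \<le> p * (card T * M + p ^ (2 * n) * p ^ (n + 2))"
      using card_popular_pairs[OF p_gt_0 X(1) Y(1), of "p ^ (n + 2)"]
      unfolding M_def T_def by (intro mult_left_mono) auto
    also have "\<dots> = p * card T * M + p ^ (3 * n + 3)"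
      by (simp only: distrib_left pow mult.assoc)
    also have "\<dots> \<le> p * card T * M + M\<^sup>2"
      using large by (simp add: M_def)
    finally have "M * (p * M) \<le> M * (p * card T + M)"
      by (simp add: algebra_simps power2_eq_square)
    then have "p * M \<le> p * card T + M"
      using \<open>M > 0\<close> by simp
    \<comment> \<open>The element missing from \<open>Z\<close> pays for the extra summand
      \<open>M\<close>.\<close>
    moreover have "M * card Z + M \<le> p * M"
      using mult_le_mono1[of "Suc (card Z)" p M] \<open>card Z < p\<close> by (simp add: mult.commute)
    ultimately have "M * card Z \<le> p * card T" by linarith
    also have "\<dots> \<le> p * ?N" using \<open>card T \<le> ?N\<close> by simp
    finally show ?thesis by (simp add: card_B)
  qed
qed

text \<open>As |Z| \<le> \<open>p\<close>, dividing |B| by \<open>p\<close> bounds \<open>M\<close>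
  below by \<open>p powr (r - 1)\<close>; it remains to compare exponents with
  \<open>3n + 3\<close>.\<close>

lemma brick_cosets:
  assumes B: "is_brick p n B" and \<epsilon>: "\<epsilon> > 0" and n: "real n \<ge> 1 / \<epsilon>"
    and large: "real (card B) > real (order G) powr (3/4 + \<epsilon>)"
  shows "real (card {C \<in> rcosets\<^bsub>G\<^esub> (vertical p n). C \<subseteq> B <#>\<^bsub>G\<^esub> B}) \<ge> real (card B) / real p"
proof -
  obtain X' Y' Z where X': "\<forall>i\<in>{1..n}. X' i \<subseteq> {0..int p - 1} \<and> X' i \<noteq> {}"
    and Y': "\<forall>i\<in>{1..n}. Y' i \<subseteq> {0..int p - 1} \<and> Y' i \<noteq> {}"
    and Z: "Z \<subseteq> {0..int p - 1}" "Z \<noteq> {}"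
    and B_eq: "B = {(x, y, z). x \<in> (\<Pi>\<^sub>E i\<in>{1..n}. X' i) \<and> y \<in> (\<Pi>\<^sub>E i\<in>{1..n}. Y' i) \<and> z \<in> Z}"
    using B by (auto simp: is_brick_def Fp_simps)
  define X where "X = (\<Pi>\<^sub>E i\<in>{1..n}. X' i)"
  define Y where "Y = (\<Pi>\<^sub>E i\<in>{1..n}. Y' i)"
  have X: "X \<subseteq> vecs p n" "X \<noteq> {}"
    using X' unfolding X_def vecs_eq by (auto intro!: PiE_mono simp: PiE_eq_empty_iff)
  have Y: "Y \<subseteq> vecs p n" "Y \<noteq> {}"
    using Y' unfolding Y_def vecs_eq by (auto intro!: PiE_mono simp: PiE_eq_empty_iff)
  have B_prod: "B = X \<times> Y \<times> Z" by (auto simp: B_eq X_def Y_def)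
  define M where "M = card X * card Y"
  define r where "r = real (2 * n + 1) * (3/4 + \<epsilon>)"
  have "card Z \<le> p" using card_mono[OF _ Z(1)] by simp
  then have "card B \<le> M * p" by (simp add: B_prod M_def card_cartesian_product)
  then have "real (card B) \<le> real M * real p" by (metis of_nat_le_iff of_nat_mult)
  moreover have "real (order G) = real p powr real (2 * n + 1)"
    using p_gt_0 unfolding order_G of_nat_power by (subst powr_realpow) simp_all
  then have "real (order G) powr (3/4 + \<epsilon>) = real p powr r"
    by (simp only: powr_powr r_def)
  ultimately have "real p powr r \<le> real M * real p" using large by linarith
  then have "real p powr r / real p \<le> real M"
    using p_gt_0 by (simp add: divide_le_eq)
  then have M_ge: "real p powr (r - 1) \<le> real M"
    using p_gt_0 by (simp add: powr_diff)
  \<comment> \<open>This makes 4n\<epsilon> - 1/2 at least 7/2, which exceeds the required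
    3.\<close>
  have "real n * \<epsilon> \<ge> 1" using n \<epsilon> by (simp add: field_simps)
  moreover have "2 * (r - 1) = 3 * real n + 4 * (real n * \<epsilon>) + 2 * \<epsilon> - 1/2"
    by (simp add: r_def field_simps)
  ultimately have "real (3 * n + 3) \<le> 2 * (r - 1)" using \<epsilon> by simp
  then have "real (p ^ (3 * n + 3)) \<le> real p powr (2 * (r - 1))"
    using p_gt_1 by (subst of_nat_power, subst powr_realpow[symmetric]) (auto intro: powr_mono)
  also have "\<dots> = (real p powr (r - 1))\<^sup>2"
    by (simp add: power2_eq_square flip: powr_add)
  also have "\<dots> \<le> (real M)\<^sup>2" using M_ge by (intro power_mono) auto
  finally have "p ^ (3 * n + 3) \<le> (card X * card Y)\<^sup>2"
    unfolding M_def [symmetric] of_nat_power[symmetric] of_nat_le_iff .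
  from card_cosets_product_ge[OF X Y Z this]
  have "card B \<le> p * card {C \<in> rcosets\<^bsub>G\<^esub> (vertical p n). C \<subseteq> B <#>\<^bsub>G\<^esub> B}"
    by (simp add: B_prod)
  then have "real (card B) \<le> real p * real (card {C \<in> rcosets\<^bsub>G\<^esub> (vertical p n). C \<subseteq> B <#>\<^bsub>G\<^esub> B})"
    unfolding of_nat_mult [symmetric] of_nat_le_iff .
  then show ?thesis
    using p_gt_0 by (simp add: divide_le_eq mult.commute)
qed

end

theorem theorem1p3:
  fixes \<epsilon> :: real
  assumes "\<epsilon> > 0"
  shows "\<exists>n0::nat. n0 > 0 \<and>
    (\<forall>(p::nat) (n::nat) (G::triple monoid) (B::triple set).
      prime p \<longrightarrow> n \<ge> n0 \<longrightarrow> G \<in> {heis_group p n, carry_group p n} \<longrightarrow>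
      is_brick p n B \<longrightarrow> real (card B) > real (order G) powr (3/4 + \<epsilon>) \<longrightarrow>
      vertical p n = center G \<and> subgroup (vertical p n) G \<and> vertical p n \<noteq> {\<one>\<^bsub>G\<^esub>} \<and>
      real (card {C \<in> rcosets\<^bsub>G\<^esub> (vertical p n). C \<subseteq> B <#>\<^bsub>G\<^esub> B}) \<ge> real (card B) / real p)"
proof (intro exI[of _ "nat \<lceil>1 / \<epsilon>\<rceil>"] conjI allI impI)
  \<comment> \<open>The witness depends on \<epsilon> alone and ensures n\<epsilon> \<ge> 1, as the
    exponent comparison requires.\<close>
  show "nat \<lceil>1 / \<epsilon>\<rceil> > 0" using assms by simp
  fix p n :: nat and G :: "triple monoid" and B :: "triple set"
  assume p: "prime p" and n: "n \<ge> nat \<lceil>1 / \<epsilon>\<rceil>" and G: "G \<in> {heis_group p n, carry_group p n}"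
    and B: "is_brick p n B" and large: "real (card B) > real (order G) powr (3/4 + \<epsilon>)"
  obtain \<kappa> where \<kappa>: "symmetric_twist p n \<kappa>" and G_eq: "G = twisted_group p n \<kappa>"
  proof -
    have "symmetric_twist p n (\<lambda>_ _. 0)" "symmetric_twist p n (vec_carry p n)"
      using p by (auto simp: symmetric_twist_def vec_carry_vec_zero intro: vec_carry_commute)
    then show ?thesis
      using G that by (auto simp: heis_group_eq_twisted carry_group_eq_twisted)
  qed
  interpret symmetric_twist p n \<kappa> by (rule \<kappa>)
  have "real n \<ge> 1 / \<epsilon>" using n by linarith
  then show "real (card {C \<in> rcosets\<^bsub>G\<^esub> (vertical p n). C \<subseteq> B <#>\<^bsub>G\<^esub> B}) \<ge> real (card B) / real p"
    using brick_cosets[OF B assms] large by (simp add: G_eq)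
  show "vertical p n = center G" "subgroup (vertical p n) G" "vertical p n \<noteq> {\<one>\<^bsub>G\<^esub>}"
    unfolding G_eq by (rule vertical_eq_center vertical_subgroup vertical_nontrivial)+
qed

end
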